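(* Let $r,c$ be positive integers, and let $\boldsymbol{t}=(t_1,\ldots,t_r)\in(0,\infty)^r$ and $\boldsymbol{s}=(s_1,\ldots,s_c)\in(0,\infty)^c$ satisfy $\sum_{i=1}^r t_i=\sum_{j=1}^c s_j$. Suppose $X$ is a random element of $\mathcal{M}_{r,c}$ (a random $r\times c$ matrix with non-negative entries) that is independent of both $\boldsymbol{Y}\sim D_{\boldsymbol{t}}$ and $\boldsymbol{V}\sim G_{\boldsymbol{t}}$. Then $$\boldsymbol{Y}X\sim D_{\boldsymbol{s}}\quad\text{if and only if}\quad \boldsymbol{V}X\sim G_{\boldsymbol{s}}.$$
   Context: $\mathcal{M}_{r,c}$ is the set of $r\times c$ real matrices with non-negative entries. Vectors are row vectors, so $\boldsymbol{Y}X$ and $\boldsymbol{V}X$ are random vectors in $\mathbb{R}^c$. For a random element $Z$, $Z\sim F$ means that $Z$ has distribution $F$. For $u>0$, $\Gamma_u$ is the Gamma distribution with scale parameter $1$ and shape parameter $u$, i.e. with density $x^{u-1}e^{-x}/\Gamma(u)$ on $(0,\infty)$. For $\boldsymbol{a}=(a_1,\ldots,a_d)\in(0,\infty)^d$, $G_{\boldsymbol{a}}=\Gamma_{a_1}\otimes\cdots\otimes\Gamma_{a_d}$ is the law of a row vector with independent components, the $i$th being $\Gamma_{a_i}$-distributed. $D_{\boldsymbol{a}}$ is the Dirichlet distribution with parameter $\boldsymbol{a}$ on the simplex $\mathcal{S}_d=\{(x_1,\ldots,x_d): x_i\ge 0,\ \sum_i x_i=1\}$, with density $\Gamma(\sum_i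 a_i)\prod_{i=1}^d x_i^{a_i-1}/\Gamma(a_i)$ with respect to the $(d-1)$-dimensional volume measure on $\mathcal{S}_d$ (normalised as Lebesgue measure in the coordinates $x_1,\ldots,x_{d-1}$; for $d=1$ it is the point mass at $1$). *)

theory Defs
  imports "HOL-Probability.Probability"
begin

definition gamma_measure :: "real \<Rightarrow> real measure" where
  "gamma_measure u =
     density lborel (\<lambda>x. ennreal (if 0 < x then x powr (u - 1) * exp (- x) / Gamma u else 0))"

definition gamma_vec_measure :: "real ^ 'n \<Rightarrow> (real ^ 'n) measure" where
  "gamma_vec_measure a =
     distr (Pi\<^sub>M UNIV (\<lambda>i. gamma_measure (a $ i))) borel (\<lambda>f. \<chi> i. f i)"

definition simplex_set :: "(real ^ 'n) set" where
  "simplex_set = {x. (\<forall>i. 0 \<le> x $ i) \<and> (\<Sum>i\<in>UNIV. x $ i) = 1}"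

text \<open>Coordinates are indexed by a finite linearly ordered type, so \<open>Max UNIV\<close> is the last
  coordinate: it is recovered from the others by requiring that the coordinates sum to 1.\<close>

definition last_completion :: "('n::{finite,linorder} \<Rightarrow> real) \<Rightarrow> real ^ 'n::{finite,linorder}" where
  "last_completion f =
     (\<chi> i. if i = Max UNIV then 1 - (\<Sum>j\<in>UNIV - {Max UNIV}. f j) else f i)"

text \<open>The volume measure on the simplex, normalised as Lebesgue measure in all coordinates but the
  last. If there is only one coordinate, the product below is over the empty index set, hence a
  point mass, and this is the point mass at the vector 1.\<close>

definition simplex_volume :: "(real ^ 'n::{finite,linorder}) measure" where
  "simplex_volume =
     density (distr (Pi\<^sub>M (UNIV - {Max UNIV}) (\<lambda>_. lborel)) borel last_completion)
       (indicator simplex_set)"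

definition dirichlet_measure ::
    "real ^ 'n::{finite,linorder} \<Rightarrow> (real ^ 'n::{finite,linorder}) measure" where
  "dirichlet_measure a =
     density simplex_volume
       (\<lambda>x. ennreal (Gamma (\<Sum>i\<in>UNIV. a $ i) *
          (\<Prod>i\<in>UNIV. x $ i powr (a $ i - 1) / Gamma (a $ i))))"

definition nonneg_matrices :: "(real ^ 'c ^ 'r) set" where
  "nonneg_matrices = {A. \<forall>i j. 0 \<le> A $ i $ j}"

text \<open>Independence of two random elements. The library constant \<open>indep_var\<close> requires both to have the
  same type, so this is stated through independence of the generated \<open>\<sigma>\<close>-algebras.\<close>

definition indep_elements ::
    "'a measure \<Rightarrow> 'b measure \<Rightarrow> ('a \<Rightarrow> 'b) \<Rightarrow> 'c measure \<Rightarrow> ('a \<Rightarrow> 'c) \<Rightarrow> bool" where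
  "indep_elements M N X L Y \<longleftrightarrow>
     prob_space.indep_set M {X -` A \<inter> space M |A. A \<in> sets N} {Y -` B \<inter> space M |B. B \<in> sets L}"

end

theory Submission imports Defs begin

text \<open>If \<open>g\<close> is \<open>\<Gamma>\<^bsub>u\<^esub>\<close>-distributed with \<open>u = \<Sum>t\<close> and independent of \<open>(X, Y)\<close>, then \<open>g *\<^sub>R Y\<close> has law
  \<open>G\<^bsub>t\<^esub>\<close>, so \<open>V v* X\<close> has the law of \<open>g *\<^sub>R (Y v* X)\<close>; applying the same fact to \<open>s\<close> gives the forward
  direction. Conversely, comparing the first two moments of the coordinate sums shows that the
  coordinate sum \<open>S\<close> of \<open>Y v* X\<close> satisfies \<open>E S = E S\<^sup>2 = 1\<close>, hence \<open>S = 1\<close> almost surely. Then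
  \<open>Y v* X\<close> is recovered from \<open>g *\<^sub>R (Y v* X)\<close> by dividing by the coordinate sum, and so its law is
  determined.\<close>

section \<open>The Gamma distribution on the line\<close>

text \<open>Kept real-valued, so that density identities are settled by real arithmetic before the
  passage to \<open>ennreal\<close>.\<close>

definition gamma_pdf :: "real \<Rightarrow> real \<Rightarrow> real" where
  "gamma_pdf u x = (if 0 < x then x powr (u - 1) * exp (- x) / Gamma u else 0)"

lemma gamma_pdf_nonneg: "0 < u \<Longrightarrow> 0 \<le> gamma_pdf u x"
  by (simp add: gamma_pdf_def Gamma_real_pos less_imp_le)

lemma borel_measurable_gamma_pdf [measurable]: "gamma_pdf u \<in> borel_measurable borel"
  unfolding gamma_pdf_def by measurable

lemma gamma_measure_eq_density: "gamma_measure u = density lborel (\<lambda>x. ennreal (gamma_pdf u x))"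
  by (simp add: gamma_measure_def gamma_pdf_def)

lemma sets_gamma_measure [simp, measurable_cong]: "sets (gamma_measure u) = sets borel"
  by (simp add: gamma_measure_def)

lemma nn_integral_gamma_measure:
  "f \<in> borel_measurable borel \<Longrightarrow>
    (\<integral>\<^sup>+x. f x \<partial>gamma_measure u) = (\<integral>\<^sup>+x. ennreal (gamma_pdf u x) * f x \<partial>lborel)"
  unfolding gamma_measure_eq_density by (subst nn_integral_density) auto

lemma nn_integral_gamma_pdf:
  assumes "0 < u"
  shows "(\<integral>\<^sup>+x. ennreal (gamma_pdf u x) \<partial>lborel) = 1"
proof -
  have G: "0 < Gamma u" using assms by (rule Gamma_real_pos)
  have "(\<integral>\<^sup>+x. ennreal (gamma_pdf u x) \<partial>lborel) =
      (\<integral>\<^sup>+x. ennreal (1 / Gamma u) * ennreal (indicator {0..} x * x powr (u - 1) / exp x) \<partial>lborel)"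
    using G by (intro nn_integral_cong)
      (auto simp: gamma_pdf_def ennreal_mult[symmetric] exp_minus field_simps indicator_def)
  also have "\<dots> = ennreal (1 / Gamma u) * ennreal (Gamma u)"
    by (subst nn_integral_cmult) (auto simp: Gamma_conv_nn_integral_real[OF assms])
  also have "\<dots> = 1"
    using G by (simp add: ennreal_mult[symmetric])
  finally show ?thesis .
qed

lemma prob_space_gamma_measure: "0 < u \<Longrightarrow> prob_space (gamma_measure u)"
  by (rule prob_spaceI) (simp add: gamma_measure_eq_density emeasure_density nn_integral_gamma_pdf)

text \<open>Size biasing: multiplying the density of shape \<open>u\<close> by \<open>x\<close>
  gives \<open>u\<close> times the density of shape \<open>u + 1\<close>, because
  \<open>Gamma (u + 1) = u * Gamma u\<close>. Taking \<open>f\<close> to be 1 and then the identity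
  yields the first two moments.\<close>

lemma nn_integral_gamma_measure_times_ident:
  assumes "0 < u" and [measurable]: "f \<in> borel_measurable borel"
  shows "(\<integral>\<^sup>+x. ennreal x * f x \<partial>gamma_measure u) = ennreal u * (\<integral>\<^sup>+x. f x \<partial>gamma_measure (u + 1))"
proof -
  have *: "gamma_pdf u x * x = u * gamma_pdf (u + 1) x" for x
  proof -
    have "Gamma u > 0" "Gamma (u + 1) = u * Gamma u"
      using assms Gamma_real_pos Gamma_plus1[of u] by (auto simp: nonpos_Ints_def)
    moreover have "0 < x \<Longrightarrow> x powr u = x powr (u - 1) * x"
      by (simp add: powr_mult_base mult.commute)
    ultimately show ?thesis
      using assms by (simp add: gamma_pdf_def)
  qed
  have "ennreal (gamma_pdf u x) * (ennreal x * f x) =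
      ennreal u * (ennreal (gamma_pdf (u + 1) x) * f x)" for x
    using assms *[of x] gamma_pdf_nonneg[of u x] gamma_pdf_nonneg[of "u + 1" x]
    by (simp add: ennreal_mult'[symmetric] mult.assoc[symmetric])
  then show ?thesis
    by (simp add: nn_integral_gamma_measure nn_integral_cmult)
qed

lemma nn_integral_gamma_measure_ident:
  assumes "0 < u"
  shows "(\<integral>\<^sup>+x. ennreal x \<partial>gamma_measure u) = ennreal u"
  using nn_integral_gamma_measure_times_ident[OF assms, of "\<lambda>_. 1"]
    prob_space.emeasure_space_1[OF prob_space_gamma_measure[of "u + 1"]] assms
  by simp

lemma AE_gamma_measure_pos: "AE x in gamma_measure u. 0 < x"
  unfolding gamma_measure_eq_density
  by (subst AE_density) (auto simp: gamma_pdf_def)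

section \<open>Borel measurability of vectors; product measures under densities and scaling\<close>

lemma borel_measurable_vec_lambda [measurable (raw)]:
  fixes f :: "'i::finite \<Rightarrow> 'a \<Rightarrow> real"
  assumes "\<And>i. f i \<in> borel_measurable M"
  shows "(\<lambda>x. \<chi> i. f i x) \<in> borel_measurable M"
proof (subst borel_measurable_euclidean_space, rule ballI)
  fix b :: "real ^ 'i" assume "b \<in> Basis"
  then obtain i where "b = axis i 1" by (auto simp: Basis_vec_def)
  then show "(\<lambda>x. (\<chi> i. f i x) \<bullet> b) \<in> borel_measurable M"
    using assms by (simp add: inner_axis)
qed

lemma borel_measurable_vec_nth' [measurable (raw)]:
  fixes f :: "'a \<Rightarrow> real ^ 'i"
  assumes "f \<in> borel_measurable M"
  shows "(\<lambda>x. f x $ i) \<in> borel_measurable M"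
  by (rule borel_measurable_continuous_on[OF _ assms]) (intro continuous_intros)

text \<open>It suffices to compare both measures on boxes, where the integral of a product of
  one-variable functions factorises. Sigma-finiteness of the densities is a separate assumption
  because it does not follow from that of the \<open>M i\<close>.\<close>

lemma PiM_density:
  fixes D :: "'i \<Rightarrow> 'a \<Rightarrow> ennreal"
  assumes "finite I" and M: "\<And>i. sigma_finite_measure (M i)"
    and D: "\<And>i. sigma_finite_measure (density (M i) (D i))"
    and [measurable]: "\<And>i. D i \<in> borel_measurable (M i)"
  shows "PiM I (\<lambda>i. density (M i) (D i)) = density (PiM I M) (\<lambda>x. \<Prod>i\<in>I. D i (x i))"
proof -
  interpret M: product_sigma_finite M by (simp add: product_sigma_finite_def M)
  interpret D: product_sigma_finite "\<lambda>i. density (M i) (D i)"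
    by (simp add: product_sigma_finite_def D)
  show ?thesis
  proof (rule D.PiM_eqI[symmetric])
    show "finite I" by fact
    show "sets (density (PiM I M) (\<lambda>x. \<Prod>i\<in>I. D i (x i))) = sets (PiM I (\<lambda>i. density (M i) (D i)))"
      by (simp cong: sets_PiM_cong)
    fix A assume "\<And>i. i \<in> I \<Longrightarrow> A i \<in> sets (density (M i) (D i))"
    then have A [measurable]: "\<And>i. i \<in> I \<Longrightarrow> A i \<in> sets (M i)" by simp
    have "emeasure (density (PiM I M) (\<lambda>x. \<Prod>i\<in>I. D i (x i))) (Pi\<^sub>E I A) =
        (\<integral>\<^sup>+x. (\<Prod>i\<in>I. D i (x i)) * indicator (Pi\<^sub>E I A) x \<partial>PiM I M)"
      using \<open>finite I\<close> A by (subst emeasure_density) (auto intro!: sets_PiM_I_finite)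
    also have "\<dots> = (\<integral>\<^sup>+x. (\<Prod>i\<in>I. D i (x i) * indicator (A i) (x i)) \<partial>PiM I M)"
    proof (rule nn_integral_cong)
      fix x assume "x \<in> space (PiM I M)"
      then have "x \<in> Pi\<^sub>E I A \<longleftrightarrow> (\<forall>i\<in>I. x i \<in> A i)"
        by (auto simp: space_PiM PiE_iff)
      then show "(\<Prod>i\<in>I. D i (x i)) * indicator (Pi\<^sub>E I A) x =
          (\<Prod>i\<in>I. D i (x i) * indicator (A i) (x i))"
        using \<open>finite I\<close>
        by (cases "x \<in> Pi\<^sub>E I A") (auto simp: indicator_def intro!: prod_zero[symmetric] prod.cong)
    qed
    also have "\<dots> = (\<Prod>i\<in>I. \<integral>\<^sup>+x. D i x * indicator (A i) x \<partial>M i)"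
      using \<open>finite I\<close> by (subst M.product_nn_integral_prod) auto
    also have "\<dots> = (\<Prod>i\<in>I. emeasure (density (M i) (D i)) (A i))"
      by (auto simp: emeasure_density intro!: prod.cong)
    finally show "emeasure (density (PiM I M) (\<lambda>x. \<Prod>i\<in>I. D i (x i))) (Pi\<^sub>E I A) =
        (\<Prod>i\<in>I. emeasure (density (M i) (D i)) (A i))" .
  qed
qed

text \<open>The image of Lebesgue measure under scaling by \<open>c\<close>, multiplied by the
  Jacobian \<open>c ^ card I\<close>, is Lebesgue measure again; on boxes this reduces to the
  one-dimensional case in each coordinate. The restriction to \<open>I\<close> keeps the scaled
  point in the space of the product measure.\<close>

lemma nn_integral_PiM_lborel_scale:
  fixes c :: real and f :: "('i \<Rightarrow> real) \<Rightarrow> ennreal"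
  assumes "0 < c" "finite I" and f [measurable]: "f \<in> borel_measurable (PiM I (\<lambda>_. lborel))"
  shows "(\<integral>\<^sup>+x. f x \<partial>PiM I (\<lambda>_. lborel)) =
    ennreal (c ^ card I) * (\<integral>\<^sup>+x. f (\<lambda>i\<in>I. c * x i) \<partial>PiM I (\<lambda>_. lborel))"
proof -
  interpret product_sigma_finite "\<lambda>_::'i. lborel :: real measure" by standard
  let ?L = "PiM I (\<lambda>_. lborel) :: ('i \<Rightarrow> real) measure"
  let ?S = "\<lambda>x. \<lambda>i\<in>I. c * x i"
  have S [measurable]: "?S \<in> measurable ?L ?L" by measurable
  have "density (distr ?L ?L ?S) (\<lambda>_. ennreal (c ^ card I)) = ?L"
  proof (rule PiM_eqI)
    fix A :: "'i \<Rightarrow> real set" assume A: "\<And>i. i \<in> I \<Longrightarrow> A i \<in> sets lborel"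
    have m: "(\<lambda>x. c * x) -` A i \<in> sets borel" if "i \<in> I" for i
      using A[OF that] measurable_sets[of "\<lambda>x. c * x" borel borel "A i"] by simp
    have "emeasure (density (distr ?L ?L ?S) (\<lambda>_. ennreal (c ^ card I))) (Pi\<^sub>E I A) =
        ennreal (c ^ card I) * emeasure ?L (?S -` Pi\<^sub>E I A \<inter> space ?L)"
      using A \<open>finite I\<close>
      by (subst emeasure_density_const) (auto simp: emeasure_distr intro!: sets_PiM_I_finite)
    also have "?S -` Pi\<^sub>E I A \<inter> space ?L = Pi\<^sub>E I (\<lambda>i. (\<lambda>x. c * x) -` A i)"
      by (auto simp: space_PiM PiE_iff)
    also have "emeasure ?L \<dots> = (\<Prod>i\<in>I. emeasure lborel ((\<lambda>x. c * x) -` A i))"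
      using m \<open>finite I\<close> by (subst emeasure_PiM) auto
    also have "ennreal (c ^ card I) * \<dots> = (\<Prod>i\<in>I. ennreal c * emeasure lborel ((\<lambda>x. c * x) -` A i))"
      using \<open>0 < c\<close> by (simp add: prod.distrib ennreal_power)
    also have "\<dots> = (\<Prod>i\<in>I. emeasure lborel (A i))"
    proof (rule prod.cong[OF refl])
      fix i assume "i \<in> I"
      have "emeasure lborel (A i) =
          emeasure (density (distr lborel borel ((*) c)) (\<lambda>_. ennreal \<bar>c\<bar>)) (A i)"
        using lborel_distr_mult'[of c] \<open>0 < c\<close> by simp
      also have "\<dots> = ennreal c * emeasure lborel ((\<lambda>x. c * x) -` A i)"
        using A[OF \<open>i \<in> I\<close>] \<open>0 < c\<close> by (simp add: emeasure_density_const emeasure_distr)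
      finally show "ennreal c * emeasure lborel ((\<lambda>x. c * x) -` A i) = emeasure lborel (A i)" ..
    qed
    finally show "emeasure (density (distr ?L ?L ?S) (\<lambda>_. ennreal (c ^ card I))) (Pi\<^sub>E I A) =
      (\<Prod>i\<in>I. emeasure lborel (A i))" .
  qed (use \<open>finite I\<close> in auto)
  then have "(\<integral>\<^sup>+x. f x \<partial>?L) = (\<integral>\<^sup>+x. f x \<partial>density (distr ?L ?L ?S) (\<lambda>_. ennreal (c ^ card I)))"
    by simp
  also have "\<dots> = ennreal (c ^ card I) * (\<integral>\<^sup>+x. f (?S x) \<partial>?L)"
    by (subst nn_integral_density) (auto simp: nn_integral_distr nn_integral_cmult)
  finally show ?thesis .
qed

section \<open>Factorisation of a Gamma vector into its total and a Dirichlet direction\<close>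

lemma sets_gamma_vec_measure [simp, measurable_cong]: "sets (gamma_vec_measure a) = sets borel"
  by (simp add: gamma_vec_measure_def)

lemma sets_dirichlet_measure [simp, measurable_cong]: "sets (dirichlet_measure a) = sets borel"
  by (simp add: dirichlet_measure_def simplex_volume_def)

lemma borel_measurable_last_completion [measurable]:
  "last_completion \<in> borel_measurable (PiM (UNIV - {Max UNIV}) (\<lambda>_. lborel))"
proof -
  have "(\<lambda>f. if i = m then 1 - (\<Sum>j\<in>UNIV - {m}. f j) else f i)
      \<in> borel_measurable (PiM (UNIV - {m}) (\<lambda>_. lborel))" for i m :: 'n
    by (cases "i = m") (auto intro!: borel_measurable_diff borel_measurable_sum
        measurable_component_singleton[where M="\<lambda>_. lborel", simplified])
  then show ?thesis
    unfolding last_completion_def by (intro borel_measurable_vec_lambda)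
qed

lemma simplex_set_borel [measurable]: "simplex_set \<in> sets borel"
  unfolding simplex_set_def by measurable

lemma nn_integral_dirichlet_measure:
  assumes [measurable]: "f \<in> borel_measurable borel"
  shows "(\<integral>\<^sup>+y. f y \<partial>dirichlet_measure a) =
    (\<integral>\<^sup>+z. indicator simplex_set (last_completion z) *
        (ennreal (Gamma (\<Sum>i\<in>UNIV. a $ i) *
          (\<Prod>i\<in>UNIV. last_completion z $ i powr (a $ i - 1) / Gamma (a $ i))) *
         f (last_completion z)) \<partial>PiM (UNIV - {Max UNIV}) (\<lambda>_. lborel))"
  unfolding dirichlet_measure_def simplex_volume_def
  by (simp add: nn_integral_density nn_integral_distr)

lemma nn_integral_gamma_vec_measure_pdf:
  fixes a :: "real ^ 'n"
  assumes a: "\<And>i. 0 < a $ i" and [measurable]: "f \<in> borel_measurable borel"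
  shows "(\<integral>\<^sup>+x. f x \<partial>gamma_vec_measure a) =
    (\<integral>\<^sup>+x. ennreal (\<Prod>i\<in>UNIV. gamma_pdf (a $ i) (x i)) * f (\<chi> i. x i) \<partial>PiM UNIV (\<lambda>_. lborel))"
proof -
  have "sigma_finite_measure (density lborel (\<lambda>x. ennreal (gamma_pdf (a $ i) x)))" for i
    using prob_space_gamma_measure[OF a[of i]]
    by (simp add: gamma_measure_eq_density prob_space_imp_sigma_finite)
  then have P: "PiM UNIV (\<lambda>i. gamma_measure (a $ i)) =
      density (PiM UNIV (\<lambda>_. lborel)) (\<lambda>x. \<Prod>i\<in>UNIV. ennreal (gamma_pdf (a $ i) (x i)))"
    unfolding gamma_measure_eq_density
    by (intro PiM_density) (auto simp: sigma_finite_lborel)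
  have [measurable]: "(\<lambda>f. \<chi> i. f i) \<in> borel_measurable (PiM UNIV (\<lambda>_::'n. lborel :: real measure))"
    by measurable
  have [measurable]: "(\<lambda>x. \<Prod>i\<in>UNIV. ennreal (gamma_pdf (a $ i) (x i))) \<in> borel_measurable (PiM UNIV (\<lambda>_. lborel))"
    by measurable
  show ?thesis
    unfolding gamma_vec_measure_def P
    using a by (simp add: nn_integral_distr nn_integral_density prod_ennreal gamma_pdf_nonneg)
qed

text \<open>This is the density identity behind the change of variables
  \<open>x = g *\<^sub>R y\<close>, with its Jacobian on the left. Since the \<open>y $ i\<close>
  sum to 1, the exponentials multiply to \<open>exp (- g)\<close>; the factor
  \<open>Gamma (\<Sum>i\<in>UNIV. a $ i)\<close> on the right cancels the denominator of the density
  of the total.\<close>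

lemma prod_gamma_pdf_scaleR:
  fixes a y :: "real ^ 'n::{finite,linorder}"
  assumes a: "\<And>i. 0 < a $ i" and g: "0 < g" and y: "(\<Sum>i\<in>UNIV. y $ i) = 1"
  shows "g ^ card (UNIV - {Max UNIV :: 'n}) * (\<Prod>i\<in>UNIV. gamma_pdf (a $ i) (g * y $ i)) =
    gamma_pdf (\<Sum>i\<in>UNIV. a $ i) g * (indicator simplex_set y *
      (Gamma (\<Sum>i\<in>UNIV. a $ i) * (\<Prod>i\<in>UNIV. y $ i powr (a $ i - 1) / Gamma (a $ i))))"
proof (cases "\<forall>i. 0 < y $ i")
  case True
  let ?s = "\<Sum>i\<in>UNIV. a $ i"
  let ?n = "card (UNIV - {Max UNIV :: 'n})"
  have s: "0 < ?s" using a by (intro sum_pos) auto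
  \<comment> \<open>With \<open>n\<close> coordinates only \<open>n - 1\<close> are free. This
    Jacobian exponent turns the power \<open>?s - n\<close> of \<open>g\<close> into
    \<open>?s - 1\<close>, as the density of shape \<open>?s\<close> requires.\<close>
  have n: "real ?n = real (card (UNIV :: 'n set)) - 1"
    by (simp add: card_Diff_singleton of_nat_diff Suc_leI card_gt_0_iff)
  have "(\<Prod>i\<in>UNIV. gamma_pdf (a $ i) (g * y $ i)) =
      (\<Prod>i\<in>UNIV. g powr (a $ i - 1) * exp (- (g * y $ i)) * (y $ i powr (a $ i - 1) / Gamma (a $ i)))"
    using True g by (intro prod.cong) (auto simp: gamma_pdf_def powr_mult)
  also have "\<dots> = g powr (\<Sum>i\<in>UNIV. a $ i - 1) * exp (- (\<Sum>i\<in>UNIV. g * y $ i)) *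
      (\<Prod>i\<in>UNIV. y $ i powr (a $ i - 1) / Gamma (a $ i))"
    using g by (simp only: prod.distrib powr_sum[symmetric] exp_sum[symmetric, OF finite] sum_negf)
  also have "(\<Sum>i\<in>UNIV. g * y $ i) = g"
    by (simp add: sum_distrib_left[symmetric] y)
  also have "g ^ ?n * (g powr (\<Sum>i\<in>UNIV. a $ i - 1) * exp (- g) *
        (\<Prod>i\<in>UNIV. y $ i powr (a $ i - 1) / Gamma (a $ i))) =
      g powr (real ?n + (\<Sum>i\<in>UNIV. a $ i - 1)) * exp (- g) *
        (\<Prod>i\<in>UNIV. y $ i powr (a $ i - 1) / Gamma (a $ i))"
    using g by (simp only: powr_add powr_realpow mult.assoc)
  also have "real ?n + (\<Sum>i\<in>UNIV. a $ i - 1) = ?s - 1"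
    by (simp add: n sum_subtractf)
  finally show ?thesis
    using g True y Gamma_real_pos[OF s]
    by (simp add: gamma_pdf_def simplex_set_def less_imp_le)
next
  case False
  then obtain i where i: "y $ i \<le> 0" by (auto simp: not_less)
  then have "gamma_pdf (a $ i) (g * y $ i) = 0"
    using g by (auto simp: gamma_pdf_def zero_less_mult_iff)
  then have "(\<Prod>i\<in>UNIV. gamma_pdf (a $ i) (g * y $ i)) = 0"
    by (intro prod_zero) auto
  \<comment> \<open>On the boundary of the simplex the product vanishes because
    \<open>0 powr p = 0\<close> for every \<open>p\<close>, including the negative exponents that
    occur when \<open>a $ i < 1\<close>. A negative coordinate is excluded by the indicator.\<close>
  moreover have "indicator simplex_set y * (\<Prod>i\<in>UNIV. y $ i powr (a $ i - 1) / Gamma (a $ i)) = 0"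
  proof (cases "y $ i = 0")
    case True
    then show ?thesis by (intro mult_eq_0_iff[THEN iffD2] disjI2 prod_zero) auto
  next
    case False
    with i have "y \<notin> simplex_set" by (auto simp: simplex_set_def not_le intro!: exI[of _ i])
    then show ?thesis by simp
  qed
  ultimately show ?thesis
    by (simp only: mult.left_commute[of "indicator simplex_set y"] mult_zero_right)
qed

text \<open>Integrating out the last coordinate and translating it by the sum of the others turns it into
  the total \<open>g\<close>; rescaling the remaining coordinates by \<open>g\<close> then gives the simplex coordinates.\<close>

lemma nn_integral_gamma_vec_measure:
  fixes a :: "real ^ 'n::{finite,linorder}"
  assumes a: "\<And>i. 0 < a $ i" and f [measurable]: "f \<in> borel_measurable borel"
  shows "(\<integral>\<^sup>+x. f x \<partial>gamma_vec_measure a) =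
    (\<integral>\<^sup>+g. \<integral>\<^sup>+y. f (g *\<^sub>R y) \<partial>dirichlet_measure a \<partial>gamma_measure (\<Sum>i\<in>UNIV. a $ i))"
proof -
  define m where "m = (Max UNIV :: 'n)"
  define I where "I = UNIV - {m}"
  let ?s = "\<Sum>i\<in>UNIV. a $ i"
  let ?L = "PiM I (\<lambda>_. lborel) :: ('n \<Rightarrow> real) measure"
  interpret product_sigma_finite "\<lambda>_::'n. lborel :: real measure" by standard
  interpret L: pair_sigma_finite ?L "lborel :: real measure"
    by (intro pair_sigma_finite.intro sigma_finite sigma_finite_lborel) (simp add: I_def)
  define H where "H x = ennreal (\<Prod>i\<in>UNIV. gamma_pdf (a $ i) (x $ i)) * f x" for x
  have H [measurable]: "H \<in> borel_measurable borel"
    unfolding H_def by measurable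
  \<comment> \<open>\<open>E z g\<close> completes the free coordinates \<open>z\<close> to a vector
    with coordinate sum \<open>g\<close>. At \<open>g = 1\<close> it is
    \<open>last_completion z\<close>.\<close>
  define E where "E z g = (\<chi> i. if i = m then g - (\<Sum>j\<in>I. z j) else z i)" for z :: "'n \<Rightarrow> real" and g
  have comp: "(\<lambda>z. z i) \<in> borel_measurable ?L" if "i \<noteq> m" for i
    using measurable_component_singleton[of i I "\<lambda>_. lborel"] that by (simp add: I_def)
  have E [measurable]: "(\<lambda>(z, g). E z g) \<in> borel_measurable (?L \<Otimes>\<^sub>M lborel)"
  proof -
    have [measurable]: "(\<lambda>p. fst p i) \<in> borel_measurable (?L \<Otimes>\<^sub>M (lborel :: real measure))" if "i \<noteq> m" for i
      by (rule measurable_compose[OF measurable_fst comp[OF that]])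
    have "(\<lambda>p. if i = m then snd p - (\<Sum>j\<in>I. fst p j) else fst p i)
        \<in> borel_measurable (?L \<Otimes>\<^sub>M (lborel :: real measure))" for i
      by (cases "i = m") (auto simp: I_def intro!: borel_measurable_diff borel_measurable_sum)
    then show ?thesis
      unfolding E_def split_beta by (intro borel_measurable_vec_lambda)
  qed
  have ins: "UNIV = insert m I" by (auto simp: I_def)
  have chi [measurable]: "(\<lambda>x. \<chi> i. x i) \<in> borel_measurable (PiM UNIV (\<lambda>_::'n. lborel :: real measure))"
    by measurable
  have completion: "last_completion z = E z 1" for z
    unfolding last_completion_def E_def I_def m_def ..

  have "(\<integral>\<^sup>+x. f x \<partial>gamma_vec_measure a) = (\<integral>\<^sup>+x. H (\<chi> i. x i) \<partial>PiM UNIV (\<lambda>_. lborel))"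
    using a by (simp add: nn_integral_gamma_vec_measure_pdf H_def)
  also have "\<dots> = (\<integral>\<^sup>+z. \<integral>\<^sup>+x. H (\<chi> i. (z(m := x)) i) \<partial>lborel \<partial>?L)"
    unfolding ins 
    by (rule product_nn_integral_insert)
      (auto simp: I_def insert_absorb intro: measurable_compose[OF chi H, simplified])
  also have "\<dots> = (\<integral>\<^sup>+z. \<integral>\<^sup>+g. H (E z g) \<partial>lborel \<partial>?L)"
  proof (rule nn_integral_cong)
    fix z :: "'n \<Rightarrow> real"
    have "(\<lambda>x. \<chi> i. (z(m := x)) i) \<in> borel_measurable borel"
      by (intro borel_measurable_vec_lambda) (simp add: fun_upd_def)
    from measurable_compose[OF this H]
    have "(\<lambda>x. H (vec_lambda (z(m := x)))) \<in> borel_measurable borel" .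
    then have "(\<integral>\<^sup>+x. H (\<chi> i. (z(m := x)) i) \<partial>lborel) =
        (\<integral>\<^sup>+g. H (\<chi> i. (z(m := - (\<Sum>j\<in>I. z j) + 1 * g)) i) \<partial>lborel)"
      by (subst nn_integral_real_affine[where c = 1 and t = "- (\<Sum>j\<in>I. z j)"])
        simp_all
    also have "\<dots> = (\<integral>\<^sup>+g. H (E z g) \<partial>lborel)"
      by (intro nn_integral_cong arg_cong[of _ _ H]) (auto simp: E_def vec_eq_iff)
    finally show "(\<integral>\<^sup>+x. H (\<chi> i. (z(m := x)) i) \<partial>lborel) = (\<integral>\<^sup>+g. H (E z g) \<partial>lborel)" .
  qed
  also have "\<dots> = (\<integral>\<^sup>+g. \<integral>\<^sup>+z. H (E z g) \<partial>?L \<partial>lborel)"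
    by (rule L.Fubini'[symmetric]) (use measurable_compose[OF E H] in \<open>simp add: split_beta'\<close>)
  also have "\<dots> = (\<integral>\<^sup>+g. ennreal (gamma_pdf ?s g) * (\<integral>\<^sup>+y. f (g *\<^sub>R y) \<partial>dirichlet_measure a) \<partial>lborel)"
  proof (rule nn_integral_cong)
    fix g :: real
    have E_meas [measurable]: "(\<lambda>z. E z h) \<in> borel_measurable ?L" for h
      using measurable_compose[OF measurable_Pair[OF measurable_ident measurable_const] E, of h] by simp
    show "(\<integral>\<^sup>+z. H (E z g) \<partial>?L) =
        ennreal (gamma_pdf ?s g) * (\<integral>\<^sup>+y. f (g *\<^sub>R y) \<partial>dirichlet_measure a)"
    proof (cases "0 < g")
      case True
      \<comment> \<open>Rescaling the free coordinates by \<open>g\<close> turns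
        \<open>E z 1\<close> into \<open>g *\<^sub>R E z 1\<close>, so the density identity
        separates the Gamma density at \<open>g\<close> from the Dirichlet density at
        \<open>E z 1\<close>.\<close>
      have *: "ennreal (g ^ card I) * H (E (\<lambda>i\<in>I. g * z i) g) =
          ennreal (gamma_pdf ?s g) * (indicator simplex_set (E z 1) *
          (ennreal (Gamma ?s * (\<Prod>i\<in>UNIV. E z 1 $ i powr (a $ i - 1) / Gamma (a $ i))) * f (g *\<^sub>R E z 1)))"
        for z
      proof -
        have scale: "E (\<lambda>i\<in>I. g * z i) g = g *\<^sub>R E z 1"
          by (auto simp: E_def vec_eq_iff I_def sum_distrib_left[symmetric] algebra_simps)
        have sum1: "(\<Sum>i\<in>UNIV. E z 1 $ i) = 1"
          unfolding ins by (subst sum.insert) (auto simp: E_def I_def intro: sum.cong)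
        have s: "0 < ?s" using a by (intro sum_pos) auto
        have [simp]: "0 \<le> (\<Prod>i\<in>UNIV. gamma_pdf (a $ i) (x i))" for x
          by (intro prod_nonneg) (auto simp: gamma_pdf_nonneg a)
        have [simp]: "0 \<le> Gamma ?s * (\<Prod>i\<in>UNIV. E z 1 $ i powr (a $ i - 1) / Gamma (a $ i))"
          using a s by (intro mult_nonneg_nonneg prod_nonneg) (auto simp: Gamma_real_pos less_imp_le)
        have "ennreal (g ^ card I) * ennreal (\<Prod>i\<in>UNIV. gamma_pdf (a $ i) (g * E z 1 $ i)) =
            ennreal (gamma_pdf ?s g * (indicator simplex_set (E z 1) *
              (Gamma ?s * (\<Prod>i\<in>UNIV. E z 1 $ i powr (a $ i - 1) / Gamma (a $ i)))))"
          using prod_gamma_pdf_scaleR[OF a True sum1] True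
          by (simp add: ennreal_mult[symmetric] I_def m_def)
        also have "\<dots> = ennreal (gamma_pdf ?s g) * (indicator simplex_set (E z 1) *
              ennreal (Gamma ?s * (\<Prod>i\<in>UNIV. E z 1 $ i powr (a $ i - 1) / Gamma (a $ i))))"
          using gamma_pdf_nonneg[OF s, of g] by (simp add: ennreal_mult indicator_def)
        finally show ?thesis
          unfolding scale H_def by (simp add: mult.assoc[symmetric])
      qed
      have meas: "(\<lambda>z. indicator simplex_set (E z 1) *
          (ennreal (Gamma ?s * (\<Prod>i\<in>UNIV. E z 1 $ i powr (a $ i - 1) / Gamma (a $ i))) * f (g *\<^sub>R E z 1)))
          \<in> borel_measurable ?L"
        by measurable
      have "(\<integral>\<^sup>+z. H (E z g) \<partial>?L) =
          ennreal (g ^ card I) * (\<integral>\<^sup>+z. H (E (\<lambda>i\<in>I. g * z i) g) \<partial>?L)"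
        using True by (intro nn_integral_PiM_lborel_scale) (auto simp: I_def[symmetric])
      also have "\<dots> = (\<integral>\<^sup>+z. ennreal (g ^ card I) * H (E (\<lambda>i\<in>I. g * z i) g) \<partial>?L)"
        by (intro nn_integral_cmult[symmetric]) measurable
      also have "\<dots> = ennreal (gamma_pdf ?s g) * (\<integral>\<^sup>+y. f (g *\<^sub>R y) \<partial>dirichlet_measure a)"
        unfolding * nn_integral_cmult[OF meas]
        by (subst nn_integral_dirichlet_measure) (simp_all add: completion I_def m_def)
      finally show ?thesis .
    next
      case False
      \<comment> \<open>Coordinates with sum \<open>g \<le> 0\<close> cannot all be positive, so one
        Gamma density vanishes and both sides are 0.\<close>
      have "H (E z g) = 0" for z
      proof -
        have "\<exists>i. E z g $ i \<le> 0"
        proof (rule ccontr)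
          assume "\<nexists>i. E z g $ i \<le> 0"
          then have pos: "0 < E z g $ i" for i by (auto simp: not_le)
          have "(\<Sum>j\<in>I. z j) \<ge> 0"
          proof (rule sum_nonneg)
            fix i assume "i \<in> I"
            then show "0 \<le> z i" using pos[of i] by (simp add: E_def I_def)
          qed
          with pos[of m] False show False by (simp add: E_def)
        qed
        then obtain i where "E z g $ i \<le> 0" ..
        then have "gamma_pdf (a $ i) (E z g $ i) = 0" by (simp add: gamma_pdf_def)
        then have "(\<Prod>i\<in>UNIV. gamma_pdf (a $ i) (E z g $ i)) = 0" by (intro prod_zero) auto
        then show ?thesis by (simp only: H_def ennreal_0 mult_zero_left)
      qed
      with False show ?thesis by (simp add: gamma_pdf_def)
    qed
  qed
  also have "\<dots> = (\<integral>\<^sup>+g. \<integral>\<^sup>+y. f (g *\<^sub>R y) \<partial>dirichlet_measure a \<partial>gamma_measure ?s)"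
  proof (rule nn_integral_gamma_measure[symmetric])
    have f_scaleR: "(\<lambda>y. f (g *\<^sub>R y)) \<in> borel_measurable borel" for g
      by measurable
    \<comment> \<open>At this point \<open>dirichlet_measure a\<close> is not known to be
      sigma-finite. Unfolding the integral over it moves the question to the sigma-finite Lebesgue
      product \<open>?L\<close>.\<close>
    show "(\<lambda>g. \<integral>\<^sup>+y. f (g *\<^sub>R y) \<partial>dirichlet_measure a) \<in> borel_measurable borel"
      unfolding nn_integral_dirichlet_measure[OF f_scaleR] completion m_def[symmetric] I_def[symmetric]
      by (rule L.M1.borel_measurable_nn_integral) (auto simp: split_beta')
  qed
  finally show ?thesis .
qed

lemma AE_dirichlet_measure_simplex: "AE y in dirichlet_measure a. y \<in> simplex_set"
  unfolding dirichlet_measure_def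
proof (subst AE_density)
  show "(\<lambda>x. ennreal (Gamma (\<Sum>i\<in>UNIV. a $ i) * (\<Prod>i\<in>UNIV. x $ i powr (a $ i - 1) / Gamma (a $ i))))
      \<in> borel_measurable simplex_volume"
    by (simp add: simplex_volume_def)
  have "AE x in simplex_volume. x \<in> simplex_set"
    unfolding simplex_volume_def by (subst AE_density) (auto simp: indicator_def)
  then show "AE x in simplex_volume. 0 < ennreal (Gamma (\<Sum>i\<in>UNIV. a $ i) *
      (\<Prod>i\<in>UNIV. x $ i powr (a $ i - 1) / Gamma (a $ i))) \<longrightarrow> x \<in> simplex_set"
    by eventually_elim simp
qed

section \<open>Equality of laws, independence and random vector-matrix products\<close>

lemma measure_eqI_nn_integral:
  assumes "sets M = sets N"
    and "\<And>f. f \<in> borel_measurable M \<Longrightarrow> (\<integral>\<^sup>+x. f x \<partial>M) = (\<integral>\<^sup>+x. f x \<partial>N)"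
  shows "M = N"
proof (rule measure_eqI)
  fix A assume "A \<in> sets M"
  then show "emeasure M A = emeasure N A"
    using assms(1) assms(2)[of "indicator A"] by simp
qed fact

text \<open>Independence is the product formula on measurable rectangles, and these determine a
  product of sigma-finite measures.\<close>

lemma (in prob_space) distr_Pair_indep_elements:
  assumes X [measurable]: "X \<in> measurable M N" and Y [measurable]: "Y \<in> measurable M L"
    and indep: "indep_elements M N X L Y"
  shows "distr M (N \<Otimes>\<^sub>M L) (\<lambda>\<omega>. (X \<omega>, Y \<omega>)) = distr M N X \<Otimes>\<^sub>M distr M L Y"
proof -
  interpret DX: prob_space "distr M N X" by (rule prob_space_distr) fact
  interpret DY: prob_space "distr M L Y" by (rule prob_space_distr) fact
  show ?thesis
  proof (rule pair_measure_eqI[symmetric])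
    fix A B assume "A \<in> sets (distr M N X)" "B \<in> sets (distr M L Y)"
    then have [measurable]: "A \<in> sets N" "B \<in> sets L" by auto
    have "prob ((X -` A \<inter> space M) \<inter> (Y -` B \<inter> space M)) =
        prob (X -` A \<inter> space M) * prob (Y -` B \<inter> space M)"
      using indep unfolding indep_elements_def by (rule indep_setD) auto
    moreover have "(\<lambda>\<omega>. (X \<omega>, Y \<omega>)) -` (A \<times> B) \<inter> space M =
        (X -` A \<inter> space M) \<inter> (Y -` B \<inter> space M)"
      by auto
    ultimately show "emeasure (distr M N X) A * emeasure (distr M L Y) B =
        emeasure (distr M (N \<Otimes>\<^sub>M L) (\<lambda>\<omega>. (X \<omega>, Y \<omega>))) (A \<times> B)"
      by (simp add: emeasure_distr emeasure_eq_measure ennreal_mult)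
  qed (auto simp: DX.sigma_finite_measure_axioms DY.sigma_finite_measure_axioms
      intro!: sets_pair_measure_cong)
qed

lemma borel_measurable_vector_matrix_mult [measurable (raw)]:
  fixes v :: "'a \<Rightarrow> real ^ 'r" and A :: "'a \<Rightarrow> real ^ 'c ^ 'r"
  assumes "v \<in> borel_measurable M" "A \<in> borel_measurable M"
  shows "(\<lambda>x. v x v* A x) \<in> borel_measurable M"
  by (rule borel_measurable_continuous_Pair[OF assms])
    (auto simp: vector_matrix_mult_def intro!: continuous_intros)

text \<open>The joint law of \<open>X\<close> and \<open>V\<close> is a product. Integrating over
  the matrix last leaves, for each fixed \<open>A\<close>, an integral against the law of the vector
  alone, where that law can be rewritten.\<close>

lemma (in prob_space) nn_integral_indep_vector_matrix_mult:
  fixes X :: "'a \<Rightarrow> real ^ 'c ^ 'r" and V :: "'a \<Rightarrow> real ^ 'r"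
  assumes X [measurable]: "X \<in> borel_measurable M" and V [measurable]: "V \<in> borel_measurable M"
    and indep: "indep_elements M borel X borel V"
    and f [measurable]: "f \<in> borel_measurable borel"
  shows "(\<integral>\<^sup>+\<omega>. f (V \<omega> v* X \<omega>) \<partial>M) =
    (\<integral>\<^sup>+A. \<integral>\<^sup>+v. f (v v* A) \<partial>distr M borel V \<partial>distr M borel X)"
proof -
  interpret DV: prob_space "distr M borel V" by (rule prob_space_distr) fact
  have "(\<integral>\<^sup>+\<omega>. f (V \<omega> v* X \<omega>) \<partial>M) =
      (\<integral>\<^sup>+p. f (snd p v* fst p) \<partial>distr M (borel \<Otimes>\<^sub>M borel) (\<lambda>\<omega>. (X \<omega>, V \<omega>)))"
    by (subst nn_integral_distr) auto
  also have "\<dots> = (\<integral>\<^sup>+A. \<integral>\<^sup>+v. f (v v* A) \<partial>distr M borel V \<partial>distr M borel X)"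
    unfolding distr_Pair_indep_elements[OF X V indep]
    by (subst DV.nn_integral_fst[symmetric]) auto
  finally show ?thesis .
qed

section \<open>Recovering a law from its Gamma-scaled version\<close>

text \<open>The expectation of \<open>(S - 1)\<^sup>2\<close> is \<open>1 - 2 + 1 = 0\<close>. The
  expansion is arranged with sums only, which avoids subtraction in \<open>ennreal\<close>. As
  \<open>ennreal\<close> sends negative reals to 0, the moments speak about \<open>S\<close> itself
  only through the assumption \<open>nonneg\<close>.\<close>

lemma AE_eq_1_of_moments:
  assumes "prob_space P" and [measurable]: "S \<in> borel_measurable P"
    and nonneg: "AE x in P. 0 \<le> S x"
    and m1: "(\<integral>\<^sup>+x. ennreal (S x) \<partial>P) = 1" and m2: "(\<integral>\<^sup>+x. ennreal (S x) ^ 2 \<partial>P) = 1"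
  shows "AE x in P. S x = 1"
proof -
  interpret prob_space P by fact
  have "(\<integral>\<^sup>+x. ennreal ((S x - 1)\<^sup>2) \<partial>P) + 2 = (\<integral>\<^sup>+x. ennreal ((S x - 1)\<^sup>2) + 2 * ennreal (S x) \<partial>P)"
    by (simp add: nn_integral_add nn_integral_cmult m1)
  also have "\<dots> = (\<integral>\<^sup>+x. ennreal (S x) ^ 2 + 1 \<partial>P)"
  proof (rule nn_integral_cong_AE, use nonneg in eventually_elim)
    fix x assume "0 \<le> S x"
    then have "ennreal ((S x - 1)\<^sup>2) + 2 * ennreal (S x) = ennreal ((S x - 1)\<^sup>2 + 2 * S x)"
      by (simp add: ennreal_mult' ennreal_plus)
    also have "(S x - 1)\<^sup>2 + 2 * S x = (S x)\<^sup>2 + 1" by (simp add: power2_eq_square algebra_simps)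
    finally show "ennreal ((S x - 1)\<^sup>2) + 2 * ennreal (S x) = ennreal (S x) ^ 2 + 1"
      using \<open>0 \<le> S x\<close> by (simp add: ennreal_power)
  qed
  also have "\<dots> = 0 + 2"
    by (simp add: nn_integral_add m2 emeasure_space_1)
  finally have "2 + (\<integral>\<^sup>+x. ennreal ((S x - 1)\<^sup>2) \<partial>P) = 2 + 0"
    by (simp only: add.commute)
  then have "(\<integral>\<^sup>+x. ennreal ((S x - 1)\<^sup>2) \<partial>P) = 0"
    unfolding ennreal_add_left_cancel by simp
  then have "AE x in P. ennreal ((S x - 1)\<^sup>2) = 0"
    by (subst (asm) nn_integral_0_iff_AE) auto
  then show ?thesis
    by eventually_elim simp
qed

text \<open>On \<open>{x. \<Sum>x = 1}\<close> the factor \<open>g\<close> is recovered from \<open>g *\<^sub>R z\<close> as its coordinate sum.\<close>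

lemma gamma_scaling_cancel:
  fixes P Q :: "(real ^ 'n) measure"
  assumes u: "0 < u"
    and sets: "sets P = sets borel" "sets Q = sets borel"
    and P1: "AE z in P. (\<Sum>j\<in>UNIV. z $ j) = 1" and Q1: "AE z in Q. (\<Sum>j\<in>UNIV. z $ j) = 1"
    and eq: "\<And>f. f \<in> borel_measurable borel \<Longrightarrow>
      (\<integral>\<^sup>+g. \<integral>\<^sup>+z. f (g *\<^sub>R z) \<partial>P \<partial>gamma_measure u) = (\<integral>\<^sup>+g. \<integral>\<^sup>+z. f (g *\<^sub>R z) \<partial>Q \<partial>gamma_measure u)"
  shows "P = Q"
proof (rule measure_eqI_nn_integral)
  interpret G: prob_space "gamma_measure u" by (rule prob_space_gamma_measure) fact
  show "sets P = sets Q" by (simp add: sets)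
  fix f :: "real ^ 'n \<Rightarrow> ennreal" assume "f \<in> borel_measurable P"
  then have f [measurable]: "f \<in> borel_measurable borel" using measurable_cong_sets[OF sets(1) refl] by auto
  define N where "N x = (1 / (\<Sum>j\<in>UNIV. x $ j)) *\<^sub>R x" for x :: "real ^ 'n"
  have N: "N (g *\<^sub>R z) = z" if "0 < g" "(\<Sum>j\<in>UNIV. z $ j) = 1" for g z
    using that by (simp add: N_def sum_distrib_left[symmetric])
  have [measurable]: "N \<in> borel_measurable borel"
    unfolding N_def by measurable
  \<comment> \<open>Testing \<open>eq\<close> with \<open>f\<close> composed with \<open>N\<close>
    removes \<open>g\<close> from the inner integral, and the outer one is then over a probability
    measure.\<close>
  have normalize: "(\<integral>\<^sup>+g. \<integral>\<^sup>+z. f (N (g *\<^sub>R z)) \<partial>R \<partial>gamma_measure u) = (\<integral>\<^sup>+z. f z \<partial>R)"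
    if R: "AE z in R. (\<Sum>j\<in>UNIV. z $ j) = 1" for R
  proof -
    have "(\<integral>\<^sup>+g. \<integral>\<^sup>+z. f (N (g *\<^sub>R z)) \<partial>R \<partial>gamma_measure u) =
        (\<integral>\<^sup>+g. \<integral>\<^sup>+z. f z \<partial>R \<partial>gamma_measure u)"
    proof (rule nn_integral_cong_AE, use AE_gamma_measure_pos in eventually_elim)
      fix g :: real assume g: "0 < g"
      show "(\<integral>\<^sup>+z. f (N (g *\<^sub>R z)) \<partial>R) = (\<integral>\<^sup>+z. f z \<partial>R)"
        by (rule nn_integral_cong_AE, use R in eventually_elim) (simp add: N g)
    qed
    then show ?thesis using G.emeasure_space_1 by simp
  qed
  show "(\<integral>\<^sup>+x. f x \<partial>P) = (\<integral>\<^sup>+x. f x \<partial>Q)"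
    using eq[of "\<lambda>x. f (N x)"] by (simp add: normalize P1 Q1)
qed

text \<open>The coordinate sum is linear, so \<open>g\<close> comes out of the \<open>k\<close>-th
  power. Almost sure positivity of \<open>g\<close> makes \<open>ennreal\<close> multiplicative here
  even where the coordinate sum is negative.\<close>

lemma nn_integral_gamma_scaled_sum_power:
  fixes P :: "(real ^ 'n) measure"
  assumes sets [measurable_cong]: "sets P = sets borel"
  shows "(\<integral>\<^sup>+g. \<integral>\<^sup>+z. ennreal (\<Sum>j\<in>UNIV. (g *\<^sub>R z) $ j) ^ k \<partial>P \<partial>gamma_measure u) =
    (\<integral>\<^sup>+g. ennreal g ^ k \<partial>gamma_measure u) * (\<integral>\<^sup>+z. ennreal (\<Sum>j\<in>UNIV. z $ j) ^ k \<partial>P)"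
proof -
  have "(\<integral>\<^sup>+g. \<integral>\<^sup>+z. ennreal (\<Sum>j\<in>UNIV. (g *\<^sub>R z) $ j) ^ k \<partial>P \<partial>gamma_measure u) =
      (\<integral>\<^sup>+g. ennreal g ^ k * (\<integral>\<^sup>+z. ennreal (\<Sum>j\<in>UNIV. z $ j) ^ k \<partial>P) \<partial>gamma_measure u)"
  proof (rule nn_integral_cong_AE, use AE_gamma_measure_pos in eventually_elim)
    fix g :: real assume "0 < g"
    then have "ennreal (\<Sum>j\<in>UNIV. (g *\<^sub>R z) $ j) = ennreal g * ennreal (\<Sum>j\<in>UNIV. z $ j)" for z :: "real ^ 'n"
      by (simp add: sum_distrib_left[symmetric] ennreal_mult')
    then show "(\<integral>\<^sup>+z. ennreal (\<Sum>j\<in>UNIV. (g *\<^sub>R z) $ j) ^ k \<partial>P) =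
        ennreal g ^ k * (\<integral>\<^sup>+z. ennreal (\<Sum>j\<in>UNIV. z $ j) ^ k \<partial>P)"
      by (simp add: power_mult_distrib nn_integral_cmult)
  qed
  then show ?thesis by (simp add: nn_integral_multc)
qed

section \<open>The equivalence of the two laws\<close>

theorem theorem3:
  fixes M :: "'a measure"
    and t :: "real ^ 'r::{finite,linorder}"
    and s :: "real ^ 'c::{finite,linorder}"
    and X :: "'a \<Rightarrow> real ^ 'c::{finite,linorder} ^ 'r::{finite,linorder}"
    and Y V :: "'a \<Rightarrow> real ^ 'r::{finite,linorder}"
  assumes "prob_space M"
    and "\<forall>i. 0 < t $ i"
    and "\<forall>j. 0 < s $ j"
    and "(\<Sum>i\<in>UNIV. t $ i) = (\<Sum>j\<in>UNIV. s $ j)"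
    and "X \<in> borel_measurable M"
    and "\<forall>\<omega>\<in>space M. X \<omega> \<in> nonneg_matrices"
    and "Y \<in> borel_measurable M"
    and "V \<in> borel_measurable M"
    and "distr M borel Y = dirichlet_measure t"
    and "distr M borel V = gamma_vec_measure t"
    and "indep_elements M borel X borel Y"
    and "indep_elements M borel X borel V"
  shows "distr M borel (\<lambda>\<omega>. Y \<omega> v* X \<omega>) = dirichlet_measure s \<longleftrightarrow>
         distr M borel (\<lambda>\<omega>. V \<omega> v* X \<omega>) = gamma_vec_measure s"
proof -
  interpret prob_space M by fact
  note [measurable] = \<open>X \<in> borel_measurable M\<close> \<open>Y \<in> borel_measurable M\<close> \<open>V \<in> borel_measurable M\<close>
  define u where "u = (\<Sum>i\<in>UNIV. t $ i)"
  have us: "u = (\<Sum>j\<in>UNIV. s $ j)" using assms(4) by (simp add: u_def)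
  have u: "0 < u" unfolding u_def using assms(2) by (intro sum_pos) auto
  let ?G = "gamma_measure u"
  let ?X = "distr M borel X"
  let ?YX = "distr M borel (\<lambda>\<omega>. Y \<omega> v* X \<omega>)"
  let ?VX = "distr M borel (\<lambda>\<omega>. V \<omega> v* X \<omega>)"
  interpret G: prob_space ?G using u by (rule prob_space_gamma_measure)
  interpret X: prob_space ?X by (rule prob_space_distr) simp
  \<comment> \<open>The total mass is 1 because this is the law of \<open>Y\<close>; no Dirichlet
    integral is evaluated.\<close>
  interpret Dt: prob_space "dirichlet_measure t"
    unfolding assms(9)[symmetric] by (rule prob_space_distr) simp
  interpret XG: pair_sigma_finite ?X ?G ..
  \<comment> \<open>The independent Gamma factor need not live on \<open>M\<close>: it enters only
    as the outer integration variable over \<open>?G\<close>.\<close>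
  have VX: "(\<integral>\<^sup>+x. f x \<partial>?VX) = (\<integral>\<^sup>+g. \<integral>\<^sup>+z. f (g *\<^sub>R z) \<partial>?YX \<partial>?G)"
    if f [measurable]: "f \<in> borel_measurable borel" for f
  proof -
    have "(\<integral>\<^sup>+x. f x \<partial>?VX) = (\<integral>\<^sup>+A. \<integral>\<^sup>+v. f (v v* A) \<partial>gamma_vec_measure t \<partial>?X)"
      using nn_integral_indep_vector_matrix_mult[OF assms(5,8,12) f] assms(10)
      by (simp add: nn_integral_distr)
    also have "\<dots> = (\<integral>\<^sup>+A. \<integral>\<^sup>+g. \<integral>\<^sup>+y. f ((g *\<^sub>R y) v* A) \<partial>dirichlet_measure t \<partial>?G \<partial>?X)"
      using assms(2) by (subst nn_integral_gamma_vec_measure) (auto simp: u_def)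
    \<comment> \<open>With \<open>g\<close> outermost, the integrals over \<open>A\<close> and
      \<open>y\<close> recombine into one over the law of \<open>Y v* X\<close>.\<close>
    also have "\<dots> = (\<integral>\<^sup>+g. \<integral>\<^sup>+A. \<integral>\<^sup>+y. f ((g *\<^sub>R y) v* A) \<partial>dirichlet_measure t \<partial>?X \<partial>?G)"
      by (rule XG.Fubini'[symmetric]) measurable
    also have "\<dots> = (\<integral>\<^sup>+g. \<integral>\<^sup>+z. f (g *\<^sub>R z) \<partial>?YX \<partial>?G)"
    proof (rule nn_integral_cong)
      fix g :: real
      have "(\<integral>\<^sup>+z. f (g *\<^sub>R z) \<partial>?YX) = (\<integral>\<^sup>+\<omega>. f (g *\<^sub>R (Y \<omega> v* X \<omega>)) \<partial>M)"
        by (subst nn_integral_distr) auto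
      also have "\<dots> = (\<integral>\<^sup>+A. \<integral>\<^sup>+y. f (g *\<^sub>R (y v* A)) \<partial>dirichlet_measure t \<partial>?X)"
        using nn_integral_indep_vector_matrix_mult[OF assms(5,7,11), of "\<lambda>z. f (g *\<^sub>R z)"] assms(9)
        by simp
      finally show "(\<integral>\<^sup>+A. \<integral>\<^sup>+y. f ((g *\<^sub>R y) v* A) \<partial>dirichlet_measure t \<partial>?X) =
          (\<integral>\<^sup>+z. f (g *\<^sub>R z) \<partial>?YX)"
        by (simp add: scaleR_vector_matrix_assoc)
    qed
    finally show ?thesis .
  qed
  have Gs: "(\<integral>\<^sup>+x. f x \<partial>gamma_vec_measure s) = (\<integral>\<^sup>+g. \<integral>\<^sup>+z. f (g *\<^sub>R z) \<partial>dirichlet_measure s \<partial>?G)"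
    if "f \<in> borel_measurable borel" for f
    using nn_integral_gamma_vec_measure[OF _ that, of s] assms(3) by (simp add: us)
  show ?thesis
  proof
    assume "?YX = dirichlet_measure s"
    then show "?VX = gamma_vec_measure s"
      by (intro measure_eqI_nn_integral) (auto simp: VX Gs)
  next
    assume eq: "?VX = gamma_vec_measure s"
    interpret YX: prob_space ?YX by (rule prob_space_distr) simp
    \<comment> \<open>\<open>Gs\<close> with \<open>f = 1\<close> transfers this mass to
      \<open>dirichlet_measure s\<close>. The mass is 1 because \<open>eq\<close> makes
      \<open>gamma_vec_measure s\<close> the law of a random vector.\<close>
    have "emeasure (gamma_vec_measure s) UNIV = 1"
      using prob_space.emeasure_space_1[OF prob_space_distr[of "\<lambda>\<omega>. V \<omega> v* X \<omega>" borel]]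
      unfolding eq[symmetric] by simp
    then have "emeasure (dirichlet_measure s) (space (dirichlet_measure s)) = 1"
      using Gs[of "\<lambda>_. 1"] G.emeasure_space_1 by (simp add: sets_eq_imp_space_eq[OF sets_gamma_vec_measure])
    then interpret Ds: prob_space "dirichlet_measure s" by (rule prob_spaceI)
    have Ds1: "AE z in dirichlet_measure s. (\<Sum>j\<in>UNIV. z $ j) = 1"
      using AE_dirichlet_measure_simplex by eventually_elim (simp add: simplex_set_def)
    have scaled: "(\<integral>\<^sup>+g. \<integral>\<^sup>+z. f (g *\<^sub>R z) \<partial>?YX \<partial>?G) =
        (\<integral>\<^sup>+g. \<integral>\<^sup>+z. f (g *\<^sub>R z) \<partial>dirichlet_measure s \<partial>?G)" if "f \<in> borel_measurable borel" for f
      using VX[OF that] Gs[OF that] eq by simp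
    \<comment> \<open>Under \<open>dirichlet_measure s\<close> the coordinate sum is almost surely
      1, so all its moments are 1. The factor \<open>c\<close>, the \<open>k\<close>-th moment of
      \<open>g\<close>, is positive and finite and cancels.\<close>
    have moment: "(\<integral>\<^sup>+z. ennreal (\<Sum>j\<in>UNIV. z $ j) ^ k \<partial>?YX) = 1"
      if "(\<integral>\<^sup>+g. ennreal g ^ k \<partial>?G) = ennreal c" "0 < c" for k c
    proof -
      have "(\<integral>\<^sup>+z. ennreal (\<Sum>j\<in>UNIV. z $ j) ^ k \<partial>dirichlet_measure s) =
          (\<integral>\<^sup>+z. 1 \<partial>dirichlet_measure s)"
        by (rule nn_integral_cong_AE, use Ds1 in eventually_elim) simp
      then have "(\<integral>\<^sup>+z. ennreal (\<Sum>j\<in>UNIV. z $ j) ^ k \<partial>dirichlet_measure s) = 1"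
        by (simp add: Ds.emeasure_space_1)
      then have "ennreal c * (\<integral>\<^sup>+z. ennreal (\<Sum>j\<in>UNIV. z $ j) ^ k \<partial>?YX) = ennreal c * 1"
        using scaled[of "\<lambda>x. ennreal (\<Sum>j\<in>UNIV. x $ j) ^ k"]
        by (simp only: nn_integral_gamma_scaled_sum_power sets_distr sets_dirichlet_measure that) simp
      then show ?thesis
        using \<open>0 < c\<close> by (subst (asm) ennreal_mult_cancel_left) auto
    qed
    \<comment> \<open>Nonnegativity of the weights in \<open>Y\<close> and of the entries of
      \<open>X\<close> rules out negative coordinate sums, which the \<open>ennreal\<close> moments
      cannot detect.\<close>
    have "AE y in distr M borel Y. y \<in> simplex_set"
      unfolding assms(9) by (rule AE_dirichlet_measure_simplex)
    then have "AE \<omega> in M. Y \<omega> \<in> simplex_set"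
      by (subst (asm) AE_distr_iff) auto
    then have "AE \<omega> in M. 0 \<le> (\<Sum>j\<in>UNIV. (Y \<omega> v* X \<omega>) $ j)"
    proof (rule AE_mp, intro AE_I2 impI)
      fix \<omega> assume "\<omega> \<in> space M" "Y \<omega> \<in> simplex_set"
      then show "0 \<le> (\<Sum>j\<in>UNIV. (Y \<omega> v* X \<omega>) $ j)"
        using assms(6) unfolding vector_matrix_mult_def
        by (auto simp: simplex_set_def nonneg_matrices_def intro!: sum_nonneg)
    qed
    then have nonneg: "AE z in ?YX. 0 \<le> (\<Sum>j\<in>UNIV. z $ j)"
      by (subst AE_distr_iff) auto
    have "AE z in ?YX. (\<Sum>j\<in>UNIV. z $ j) = 1"
    proof (rule AE_eq_1_of_moments[OF YX.prob_space_axioms _ nonneg])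
      show "(\<integral>\<^sup>+z. ennreal (\<Sum>j\<in>UNIV. z $ j) \<partial>?YX) = 1"
        using moment[of 1 u] u by (simp add: nn_integral_gamma_measure_ident)
      \<comment> \<open>Size biasing turns the second moment into \<open>u\<close> times the mean
        \<open>u + 1\<close> of the Gamma law of shape \<open>u + 1\<close>.\<close>
      have "(\<integral>\<^sup>+g. ennreal g ^ 2 \<partial>?G) = ennreal (u * (u + 1))"
        using nn_integral_gamma_measure_times_ident[OF u, of ennreal] u
        by (simp add: power2_eq_square nn_integral_gamma_measure_ident ennreal_mult')
      then show "(\<integral>\<^sup>+z. ennreal (\<Sum>j\<in>UNIV. z $ j) ^ 2 \<partial>?YX) = 1"
        by (rule moment) (use u in simp)
    qed simp
    then show "?YX = dirichlet_measure s"
      by (intro gamma_scaling_cancel[OF u]) (auto simp: Ds1 scaled)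
  qed
qed

end
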